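(* Let $\pi$ be a DI-sortable permutation of $[n]$ with ADI word $W$, and suppose the diagonal steps of the Schröder path $\Phi(W)$ have heights $h_1,h_2,\dots,h_k$ (in order along the path). Then the right-to-left minima of $\pi$ are exactly $1,h_1+1,h_2+1,\dots,h_k+1$.
   Context: A right-to-left minimum of $\pi$ is an entry $\pi_i$ with $\pi_i<\pi_j$ for all $j>i$. A permutation $\pi=\pi_1\cdots\pi_n$ of $[n]$ is processed by a machine consisting of an input (initially $\pi_1,\dots,\pi_n$), a first stack, a second stack, and an output, with operations: $\mathsf{E}$ moves the next input entry onto the top of the first stack; $\mathsf{N}$ pops the top of the first stack and pushes it onto the second stack; $\mathsf{C}$ pops the top of the second stack to the output. A DI word of $\pi$ is a word over $\{\mathsf{E},\mathsf{N},\mathsf{C}\}$ whose operations are all legal when applied in order starting from $\pi$ in the input and empty stacks, whose final output is $12\cdots n$, and during which the first stack's entries always decrease from top to bottom and the second stack's entries always increase from top to bottom; $\pi$ is DI-sortable if it has a DI word. The ADI word of a DI-sortable $\pi$ is the word of operations performed by the following algorithm, which at each stage performs the first applicable step: (1) if the top entry of the second stack is the smallest value not yet output, perform $\mathsf{C}$; (2) if the first stack is nonempty and its $m$ entries are exactly the next $m$ values to be output, transfer all of them to the second stack by $m$ successive $\mathsf{N}$ operations; (3) otherwise, if the next input entry is smaller than the top of the second stack and larger than the top of the first stack (each comparison counting as satisfied if the corresponding stack is empty), perform $\mathsf{E}$; (4) otherwise perform $\mathsf{N}$. In an ADI word, every maximal block of consecutive $\mathsf{C}$'s is immediately preceded by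 $\mathsf{E}\mathsf{N}$. The map $\Phi$: given an ADI word $W$ with $k'$ maximal blocks of consecutive $\mathsf{C}$'s of lengths $\tau_1,\dots,\tau_{k'}$ (in order), set $\ell_i=\tau_1+\cdots+\tau_i$. Form $T$ by replacing each substring $\mathsf{E}\mathsf{N}\mathsf{C}^{\tau_i}$ (a maximal block of $\mathsf{C}$'s with the two letters preceding it) by a single $\mathsf{N}$. Form $S_{\mathsf{D}}$ from $T$ by replacing, for each $i\in[k']$, the $\ell_i$-th $\mathsf{N}$ of $T$ by $\mathsf{D}$; delete the final letter (a $\mathsf{D}$) of $S_{\mathsf{D}}$ to obtain $\Phi(W)$, a word over $\{\mathsf{E},\mathsf{N},\mathsf{D}\}$ viewed as a lattice path from $(0,0)$ with steps $\mathsf{E}=(1,0)$, $\mathsf{N}=(0,1)$, $\mathsf{D}=(1,1)$. The height of a diagonal step $\mathsf{D}$ in a path $S$ is $\#_{\mathsf{N}}(S')+\#_{\mathsf{D}}(S')$, where $S'$ is the prefix of $S$ ending with that step (i.e., the $y$-coordinate of the endpoint of that step). *)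

theory Defs
  imports Complex_Main "HOL-Combinatorics.Multiset_Permutations"
begin

definition rtl_minima :: "nat list \<Rightarrow> nat set" where
  "rtl_minima p =
     {p ! i | i. i < length p \<and> (\<forall>j. i < j \<and> j < length p \<longrightarrow> p ! i < p ! j)}"


text \<open>The two-stack machine. In both stacks the head of the list is the top of the stack;
  the output is listed in the order in which the entries were output.\<close>

datatype oper = OpE | OpN | OpC

datatype machine =
  Machine (input: "nat list") (stack1: "nat list") (stack2: "nat list") (emitted: "nat list")

definition initial :: "nat list \<Rightarrow> machine" where
  "initial p = Machine p [] [] []"

text \<open>The result is \<open>None\<close> if the operation is not legal.\<close>

fun perform :: "oper \<Rightarrow> machine \<Rightarrow> machine option" where
  "perform OpE (Machine (x # xs) s t out) = Some (Machine xs (x # s) t out)"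
| "perform OpN (Machine xs (x # s) t out) = Some (Machine xs s (x # t) out)"
| "perform OpC (Machine xs s (x # t) out) = Some (Machine xs s t (out @ [x]))"
| "perform _ _ = None"

fun run :: "oper list \<Rightarrow> machine \<Rightarrow> machine option" where
  "run [] m = Some m"
| "run (a # w) m = (case perform a m of None \<Rightarrow> None | Some m' \<Rightarrow> run w m')"


definition DI_stacks :: "machine \<Rightarrow> bool" where
  "DI_stacks m \<longleftrightarrow> sorted_wrt (>) (stack1 m) \<and> sorted_wrt (<) (stack2 m)"

definition DI_word :: "nat list \<Rightarrow> oper list \<Rightarrow> bool" where
  "DI_word p w \<longleftrightarrow>
     (\<exists>m. run w (initial p) = Some m \<and> emitted m = [1..<Suc (length p)]) \<and>
     (\<forall>i \<le> length w. \<forall>m. run (take i w) (initial p) = Some m \<longrightarrow> DI_stacks m)"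

definition DI_sortable :: "nat list \<Rightarrow> bool" where
  "DI_sortable p \<longleftrightarrow> (\<exists>w. DI_word p w)"


text \<open>The values not yet output, in increasing order.\<close>

definition pending :: "machine \<Rightarrow> nat list" where
  "pending m = sort (input m @ stack1 m @ stack2 m)"

text \<open>The operations performed in one stage of the algorithm.\<close>

definition ADI_stage :: "machine \<Rightarrow> oper list" where
  "ADI_stage m =
     (if stack2 m \<noteq> [] \<and> hd (stack2 m) = hd (pending m) then [OpC]
      else if stack1 m \<noteq> [] \<and> set (stack1 m) = set (take (length (stack1 m)) (pending m))
        then replicate (length (stack1 m)) OpN
      else if input m \<noteq> [] \<and> (stack2 m = [] \<or> hd (input m) < hd (stack2 m)) \<and>
              (stack1 m = [] \<or> hd (stack1 m) < hd (input m))
        then [OpE]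
      else [OpN])"

definition weight :: "machine \<Rightarrow> nat" where
  "weight m = 3 * length (input m) + 2 * length (stack1 m) + length (stack2 m)"

lemma perform_weight: "perform a m = Some m' \<Longrightarrow> weight m' < weight m"
  by (cases "(a, m)" rule: perform.cases) (auto simp: weight_def)

lemma run_weight_le: "run w m = Some m' \<Longrightarrow> weight m' \<le> weight m"
  by (induction w arbitrary: m) (auto split: option.splits dest!: perform_weight, fastforce)

lemma run_weight: "run w m = Some m' \<Longrightarrow> w \<noteq> [] \<Longrightarrow> weight m' < weight m"
  by (cases w) (auto split: option.splits dest!: perform_weight run_weight_le)

lemma ADI_stage_nonempty: "ADI_stage m \<noteq> []"
  by (simp add: ADI_stage_def)

text \<open>The algorithm stops when everything has been output. It is also cut off, so as to be a
  total function, if the final ``otherwise'' step calls for an \<open>OpN\<close> while the first stack is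
  empty, which can only happen for inputs that are not DI-sortable.\<close>

function ADI_from :: "machine \<Rightarrow> oper list" where
  "ADI_from m =
     (if pending m = [] then []
      else case run (ADI_stage m) m of
             None \<Rightarrow> []
           | Some m' \<Rightarrow> ADI_stage m @ ADI_from m')"
  by pat_completeness auto
termination
  by (relation "measure weight") (auto intro: run_weight simp: ADI_stage_nonempty)

declare ADI_from.simps [simp del]

definition ADI_word :: "nat list \<Rightarrow> oper list" where
  "ADI_word p = ADI_from (initial p)"


datatype path_step = StepE | StepN | StepD

lemma length_dropWhile_less [termination_simp]: "length (dropWhile P w) < Suc (length w)"
  by (simp add: length_dropWhile_le less_Suc_eq_le)

lemma length_dropWhile_less3 [termination_simp]:
  "length (dropWhile P w) < Suc (Suc (Suc (length w)))"
  by (meson length_dropWhile_less less_SucI)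

text \<open>The lengths of the maximal blocks of consecutive \<open>OpC\<close>'s, in order.\<close>

fun C_blocks :: "oper list \<Rightarrow> nat list" where
  "C_blocks [] = []"
| "C_blocks (OpC # w) =
     Suc (length (takeWhile (\<lambda>a. a = OpC) w)) # C_blocks (dropWhile (\<lambda>a. a = OpC) w)"
| "C_blocks (_ # w) = C_blocks w"

text \<open>The word \<open>T\<close>: each maximal block of \<open>OpC\<close>'s together with the \<open>OpE\<close>, \<open>OpN\<close> before it becomes
  one north step. The equation for a leading \<open>OpC\<close> covers blocks not preceded by \<open>OpE\<close>, \<open>OpN\<close>,
  which do not occur in ADI words; its value is irrelevant.\<close>

fun contract :: "oper list \<Rightarrow> path_step list" where
  "contract [] = []"
| "contract (OpE # OpN # OpC # w) = StepN # contract (dropWhile (\<lambda>a. a = OpC) w)"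
| "contract (OpE # w) = StepE # contract w"
| "contract (OpN # w) = StepN # contract w"
| "contract (OpC # w) = contract w"

definition partial_sums :: "nat list \<Rightarrow> nat set" where
  "partial_sums \<tau> = {sum_list (take i \<tau>) | i. i \<in> {1..length \<tau>}}"

text \<open>\<open>diagonalize L j w\<close> replaces the \<open>l\<close>-th north step by a diagonal step for every \<open>l \<in> L\<close>,
  where \<open>j\<close> is the number of north steps that were read before \<open>w\<close>.\<close>

fun diagonalize :: "nat set \<Rightarrow> nat \<Rightarrow> path_step list \<Rightarrow> path_step list" where
  "diagonalize L j [] = []"
| "diagonalize L j (StepN # w) =
     (if Suc j \<in> L then StepD else StepN) # diagonalize L (Suc j) w"
| "diagonalize L j (a # w) = a # diagonalize L j w"

definition Phi :: "oper list \<Rightarrow> path_step list" where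
  "Phi W = butlast (diagonalize (partial_sums (C_blocks W)) 0 (contract W))"

text \<open>The heights of the diagonal steps, in order along the path.\<close>

definition heights :: "path_step list \<Rightarrow> nat list" where
  "heights S =
     [count_list (take (Suc i) S) StepN + count_list (take (Suc i) S) StepD.
        i \<leftarrow> [0..<length S], S ! i = StepD]"

end

theory Submission
  imports Defs
begin

text \<open>The values output first in a block of \<open>OpC\<close>'s are the right-to-left minima. If \<open>x\<close> is a
  right-to-left minimum, then at the time it enters the first stack every smaller pending value lies
  in the first stack, which step (2) would already have emptied; so \<open>x\<close> is the smallest pending
  value and is passed on and output at once. Conversely, step (2) only ever applies to a
  single entry that has just been read, and this entry then begins a block.

  That the algorithm does sort a DI-sortable permutation is shown by maintaining that the current
  state can still be completed to a sorting: in steps (3) and (4) the next letter of any completion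
  is forced, because a value \<open>y\<close> in the second stack and an \<open>x > y\<close> that has to get
  out of the way of some \<open>z < y\<close> block each other; in steps (1) and (2) the smallest pending value
  can be erased from any completion.\<close>

section \<open>States that can be completed to a sorting\<close>

text \<open>Only relative order enters, neither the output so far nor the range of values, so that
  values can be erased. Order is checked when an entry leaves a stack; this suffices because every
  entry has to leave.\<close>

inductive completable :: "nat list \<Rightarrow> nat list \<Rightarrow> nat list \<Rightarrow> bool" where
  completable_done: "completable [] [] []"
| completable_E: "completable xs (x # s) t \<Longrightarrow> completable (x # xs) s t"
| completable_N: "completable xs s (x # t) \<Longrightarrow> \<forall>y\<in>set s. y < x \<Longrightarrow> completable xs (x # s) t"
| completable_C: "completable xs s t \<Longrightarrow> \<forall>y\<in>set xs \<union> set s \<union> set t. x < y \<Longrightarrow>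
    completable xs s (x # t)"

lemma completable_sorted:
  "completable xs s t \<Longrightarrow> sorted_wrt (>) s \<and> sorted_wrt (<) t"
  by (induction rule: completable.induct) auto

text \<open>Dropping the moves of the discarded values leaves a completion: every side condition
  compares a moved value with all values of a list.\<close>

lemma completable_filter:
  "completable xs s t \<Longrightarrow> completable (filter P xs) (filter P s) (filter P t)"
  by (induction rule: completable.induct) (auto intro: completable.intros)

lemma completable_removeAll:
  "completable xs s t \<Longrightarrow> completable (removeAll a xs) (removeAll a s) (removeAll a t)"
  using completable_filter[of xs s t "\<lambda>b. a \<noteq> b"] by (simp add: removeAll_filter_not_eq)

text \<open>As \<open>z\<close> must be output before \<open>y\<close>, the value \<open>y\<close>
  stays put until \<open>z\<close> is out. But \<open>x\<close> has to move to the second stack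
  before \<open>z\<close> does, and \<open>x > y\<close> cannot lie above \<open>y\<close>. An
  \<open>x\<close> still in the input stands in front of \<open>z\<close> and so reaches the first
  stack before it.\<close>

lemma not_completable:
  assumes "completable xs s t" "y \<in> set t" "z < y" "y < x"
    and "x \<in> set s \<and> z \<in> set xs \<union> set s \<or> (\<exists>us vs. xs = us @ x # vs \<and> z \<in> set vs)"
  shows False
  using assms
proof (induction rule: completable.induct)
  case completable_done
  then show ?case by simp
next
  case (completable_E xs e s t)
  have e: "\<forall>a\<in>set s. a < e"
    using completable_sorted[OF completable_E.hyps] by simp
  show ?case
    using completable_E.prems(4)
  proof (elim disjE conjE exE)
    assume "x \<in> set s" "z \<in> set (e # xs) \<union> set s"
    moreover from this have "z \<noteq> e"
      using e completable_E.prems(2,3) by auto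
    ultimately show False
      using completable_E.IH completable_E.prems(1-3) by simp
  next
    fix us vs
    assume "e # xs = us @ x # vs" "z \<in> set vs"
    then show False
      using completable_E.IH completable_E.prems(1-3) by (cases us) auto
  qed
next
  case (completable_N xs s e t)
  have "e < y"
    using completable_sorted[OF completable_N.hyps(1)] completable_N.prems(1) by simp
  then have "x \<noteq> e" and "x \<in> set s \<Longrightarrow> z \<noteq> e"
    using completable_N.hyps(2) completable_N.prems(2,3) by auto
  then show ?case
    using completable_N.IH completable_N.prems by auto
next
  case (completable_C xs s t e)
  have "z \<in> set xs \<union> set s"
    using completable_C.prems by auto
  then have "e < z"
    using completable_C.hyps by blast
  then have "y \<noteq> e"
    using completable_C.prems by auto
  with completable_C show ?case by simp
qed

section \<open>From DI words to completable states\<close>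

lemma run_length:
  assumes "run w m = Some m'"
  shows "length (input m') + length (stack1 m') + length (stack2 m') + length (emitted m') =
    length (input m) + length (stack1 m) + length (stack2 m) + length (emitted m)"
  using assms
proof (induction w arbitrary: m)
  case (Cons a w)
  then obtain m1 where m1: "perform a m = Some m1" "run w m1 = Some m'"
    by (auto split: option.splits)
  show ?case
    using Cons.IH[OF m1(2)] m1(1) by (cases "(a, m)" rule: perform.cases) auto
qed simp

lemma run_emitted:
  assumes "run w m = Some m'"
  shows "\<exists>out. emitted m' = emitted m @ out \<and>
    set (input m) \<union> set (stack1 m) \<union> set (stack2 m) =
    set out \<union> set (input m') \<union> set (stack1 m') \<union> set (stack2 m')"
  using assms
proof (induction w arbitrary: m)
  case (Cons a w)
  then obtain m1 where m1: "perform a m = Some m1" "run w m1 = Some m'"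
    by (auto split: option.splits)
  obtain out where out: "emitted m' = emitted m1 @ out"
    "set (input m1) \<union> set (stack1 m1) \<union> set (stack2 m1) =
    set out \<union> set (input m') \<union> set (stack1 m') \<union> set (stack2 m')"
    using Cons.IH[OF m1(2)] by blast
  show ?case
    using m1(1) out by (cases "(a, m)" rule: perform.cases) auto
qed simp

lemma completable_if_run:
  assumes "run w m = Some m'" "sorted_wrt (<) (emitted m')"
    and "input m' = []" "stack1 m' = []" "stack2 m' = []"
    and "\<forall>i \<le> length w. \<forall>m1. run (take i w) m = Some m1 \<longrightarrow> DI_stacks m1"
  shows "completable (input m) (stack1 m) (stack2 m)"
  using assms
proof (induction w arbitrary: m)
  case Nil
  then show ?case by (auto intro: completable_done)
next
  case (Cons a w)
  then obtain m1 where m1: "perform a m = Some m1" "run w m1 = Some m'"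
    by (auto split: option.splits)
  have "\<forall>i \<le> length w. \<forall>m2. run (take i w) m1 = Some m2 \<longrightarrow> DI_stacks m2"
  proof (intro allI impI)
    fix i m2
    assume "i \<le> length w" "run (take i w) m1 = Some m2"
    then show "DI_stacks m2"
      using Cons.prems(6)[rule_format, of "Suc i"] m1(1) by simp
  qed
  then have IH: "completable (input m1) (stack1 m1) (stack2 m1)"
    using Cons.IH m1(2) Cons.prems by blast
  have "DI_stacks m"
    using Cons.prems(6)[rule_format, of 0] by simp
  obtain out where out: "emitted m' = emitted m1 @ out"
    "set (input m1) \<union> set (stack1 m1) \<union> set (stack2 m1) = set out"
    using run_emitted[OF m1(2)] Cons.prems by auto
  \<comment> \<open>The sorted final output lists the values still present after those already
    emitted. When \<open>a\<close> is \<open>OpC\<close>, the last entry of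
    \<open>emitted m1\<close> is the value just output, which gives the side condition of
    \<open>completable_C\<close>.\<close>
  have "\<forall>y\<in>set (emitted m1). \<forall>x\<in>set (input m1) \<union> set (stack1 m1) \<union> set (stack2 m1). y < x"
    using Cons.prems(2) out by (simp add: sorted_wrt_append)
  then show ?case
    using m1(1) IH \<open>DI_stacks m\<close>
    by (cases "(a, m)" rule: perform.cases)
       (auto simp: DI_stacks_def intro: completable_E completable_N intro!: completable_C)
qed

lemma completable_if_DI_sortable:
  assumes "DI_sortable p"
  shows "completable p [] []"
proof -
  obtain w m where w: "run w (initial p) = Some m" "emitted m = [1..<Suc (length p)]"
    "\<forall>i \<le> length w. \<forall>m. run (take i w) (initial p) = Some m \<longrightarrow> DI_stacks m"
    using assms unfolding DI_sortable_def DI_word_def by blast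
  have "input m = []" "stack1 m = []" "stack2 m = []"
    using run_length[OF w(1)] w(2) by (simp_all add: initial_def del: upt_Suc)
  then show ?thesis
    using completable_if_run[OF w(1)] w(2,3) by (simp add: initial_def sorted_wrt_upt del: upt_Suc)
qed


section \<open>The course of the algorithm\<close>

text \<open>The third clause makes the first stack empty as soon as \<open>Suc l\<close> is in the
  second. The fourth confines step (2) to a single entry: while a smaller value waits in the input,
  the first stack cannot hold the next outputs.\<close>

definition ADI_invariant :: "nat \<Rightarrow> nat \<Rightarrow> machine \<Rightarrow> bool" where
  "ADI_invariant n l m \<longleftrightarrow>
     pending m = [Suc l..<Suc n] \<and>
     completable (input m) (stack1 m) (stack2 m) \<and>
     (\<forall>a\<in>set (stack1 m). \<forall>b\<in>set (stack2 m). a < b) \<and>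
     (stack1 m = [] \<or> stack1 m = [Suc l] \<or> (\<exists>z\<in>set (input m). \<forall>a\<in>set (stack1 m). z < a))"

text \<open>\<open>ADI_trace l xs s t w\<close>: the algorithm performs \<open>w\<close> from the state with input \<open>xs\<close> and
  stacks \<open>s\<close>, \<open>t\<close> after having output \<open>1, \<dots>, l\<close>.\<close>

inductive ADI_trace :: "nat \<Rightarrow> nat list \<Rightarrow> nat list \<Rightarrow> nat list \<Rightarrow> oper list \<Rightarrow> bool" where
  trace_done: "ADI_trace l [] [] [] []"
| trace_output: "ADI_trace (Suc l) xs [] t w \<Longrightarrow> ADI_trace l xs [] (Suc l # t) (OpC # w)"
| trace_transfer: "ADI_trace l xs [] (Suc l # t) w \<Longrightarrow> ADI_trace l xs [Suc l] t (OpN # w)"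
| trace_enter: "ADI_trace l xs (x # s) t w \<Longrightarrow> Suc l \<notin> set s \<union> set t \<Longrightarrow>
    (\<forall>y\<in>set xs. x < y) \<longleftrightarrow> s = [] \<and> x = Suc l \<Longrightarrow> ADI_trace l (x # xs) s t (OpE # w)"
| trace_push: "ADI_trace l xs s (a # t) w \<Longrightarrow> Suc l \<notin> set (a # s) \<union> set t \<Longrightarrow>
    ADI_trace l xs (a # s) t (OpN # w)"

lemma sort_eq_if_mset_eq: "sort xs = ys \<Longrightarrow> mset xs = mset zs \<Longrightarrow> sort zs = ys"
  by (intro properties_for_sort) auto

section \<open>A single stage of the algorithm\<close>

context
  fixes n l :: nat and xs s t out :: "nat list" and m :: machine
  assumes m: "m = Machine xs s t out" and inv: "ADI_invariant n l m"
begin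

lemma pending_m: "pending m = [Suc l..<Suc n]"
  and completable_m: "completable xs s t"
  and stacks_less: "a \<in> set s \<Longrightarrow> b \<in> set t \<Longrightarrow> a < b"
  and stack1_m: "s = [] \<or> s = [Suc l] \<or> (\<exists>z\<in>set xs. \<forall>a\<in>set s. z < a)"
  using inv by (auto simp: ADI_invariant_def m simp del: upt_Suc)

lemma mset_pending: "mset (xs @ s @ t) = mset [Suc l..<Suc n]"
  using pending_m mset_sort[of "\<lambda>a. a" "xs @ s @ t"] by (simp add: pending_def m del: upt_Suc)

lemma set_pending: "set xs \<union> set s \<union> set t = {Suc l..n}"
  using mset_eq_setD[OF mset_pending]
  by (simp add: Un_assoc atLeastLessThanSuc_atLeastAtMost del: upt_Suc)

lemma distinct_pending: "distinct (xs @ s @ t)"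
  using mset_eq_imp_distinct_iff[OF mset_pending] by (simp del: upt_Suc distinct_append)

lemma pending_move:
  "mset xs + mset s + mset t = mset (input m') + mset (stack1 m') + mset (stack2 m') \<Longrightarrow>
   pending m' = [Suc l..<Suc n]"
  unfolding pending_def
  by (rule sort_eq_if_mset_eq[OF pending_m[unfolded pending_def]]) (simp add: m add.assoc)

lemma sorted_stacks: "sorted_wrt (>) s" "sorted_wrt (<) t"
  using completable_m completable_sorted by blast+

context
  assumes nonempty: "pending m \<noteq> []"
begin

lemma least_pending: "Suc l \<in> set xs \<union> set s \<union> set t" "hd (pending m) = Suc l" "Suc l \<le> n"
  using nonempty unfolding set_pending pending_m by (simp_all del: upt_Suc)

lemma least_less: "y \<in> set xs \<union> set s \<union> set t \<Longrightarrow> y = Suc l \<or> Suc l < y"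
  unfolding set_pending by auto

lemma least_in_stack2_is_top: "Suc l \<in> set t \<Longrightarrow> t = Suc l # tl t"
  using sorted_stacks(2) least_less by (cases t) fastforce+

lemma case_output:
  assumes "Suc l \<in> set t"
  shows "s = []" "ADI_stage m = [OpC]" "ADI_invariant n (Suc l) (Machine xs [] (tl t) (out @ [Suc l]))"
proof -
  obtain t' where t: "t = Suc l # t'"
    using least_in_stack2_is_top[OF assms] by blast
  show s: "s = []"
    using stacks_less[OF _ assms] least_less by (cases s) fastforce+
  show "ADI_stage m = [OpC]"
    using least_pending by (simp add: ADI_stage_def m t)
  have "Suc l \<notin> set xs" "Suc l \<notin> set t'"
    using distinct_pending by (auto simp: t)
  then have "completable xs [] t'"
    using completable_removeAll[OF completable_m, of "Suc l"] by (simp add: s t)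
  moreover have "mset (xs @ t') = mset [Suc (Suc l)..<Suc n]"
    using mset_pending least_pending(3) by (simp add: s t upt_conv_Cons del: upt_Suc)
  then have "sort (xs @ t') = [Suc (Suc l)..<Suc n]"
    by (intro properties_for_sort) (simp_all del: upt_Suc)
  ultimately show "ADI_invariant n (Suc l) (Machine xs [] (tl t) (out @ [Suc l]))"
    by (simp add: ADI_invariant_def pending_def t del: upt_Suc)
qed

lemma case_transfer:
  assumes "s = [Suc l]"
  shows "ADI_stage m = [OpN]" "ADI_invariant n l (Machine xs [] (Suc l # t) out)"
proof -
  have not_in: "Suc l \<notin> set xs" "Suc l \<notin> set t"
    using distinct_pending assms by auto
  have "take (length s) (pending m) = [Suc l]"
    using least_pending(3) pending_m assms by (simp add: upt_conv_Cons del: upt_Suc)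
  then show "ADI_stage m = [OpN]"
    using not_in(2) least_pending(2) assms by (cases t) (auto simp: ADI_stage_def m)
  \<comment> \<open>The given completion need not begin by moving \<open>Suc l\<close>. Erase this
    value, then put it on top of the second stack, from where it can leave at once.\<close>
  have "completable xs [] t"
    using completable_removeAll[OF completable_m, of "Suc l"] not_in by (simp add: assms)
  moreover have "\<forall>y\<in>set xs \<union> set t. Suc l < y"
    using least_less not_in by blast
  ultimately have "completable xs [] (Suc l # t)"
    by (auto intro: completable_C)
  moreover have "pending (Machine xs [] (Suc l # t) out) = [Suc l..<Suc n]"
    by (intro pending_move) (simp add: assms)
  ultimately show "ADI_invariant n l (Machine xs [] (Suc l # t) out)"
    by (simp add: ADI_invariant_def del: upt_Suc)
qed

context
  assumes not_stack2: "Suc l \<notin> set t" and not_stack1: "s \<noteq> [Suc l]"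
begin

lemma smaller_in_input: "s \<noteq> [] \<Longrightarrow> \<exists>z\<in>set xs. \<forall>a\<in>set s. z < a"
  using stack1_m not_stack1 by blast

lemma least_not_in_stack1: "Suc l \<notin> set s"
  using smaller_in_input least_less by (cases "s = []") fastforce+

text \<open>Step (2) would need \<open>Suc l\<close>, the first pending value, in the first stack,
  and step (1) would need it in the second; only steps (3) and (4) remain.\<close>

lemma stage_eq:
  "ADI_stage m =
     (if xs \<noteq> [] \<and> (t = [] \<or> hd xs < hd t) \<and> (s = [] \<or> hd s < hd xs) then [OpE] else [OpN])"
proof -
  have "set s \<noteq> set (take (length s) (pending m))" if "s \<noteq> []"
  proof -
    have "Suc l \<in> set (take (length s) (pending m))"
      using that least_pending(3) pending_m
      by (cases s) (auto simp: upt_conv_Cons simp del: upt_Suc)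
    then show ?thesis
      using least_not_in_stack1 by blast
  qed
  then show ?thesis
    using not_stack2 least_pending(2) by (cases t) (auto simp: ADI_stage_def m)
qed

lemma case_enter:
  assumes stage: "ADI_stage m = [OpE]"
  obtains x xs' where "xs = x # xs'" "ADI_invariant n l (Machine xs' (x # s) t out)"
    "(\<forall>y\<in>set xs'. x < y) \<longleftrightarrow> s = [] \<and> x = Suc l"
proof -
  from stage obtain x xs' where xs: "xs = x # xs'"
    and hds: "t = [] \<or> x < hd t" "s = [] \<or> hd s < x"
    by (cases xs) (auto simp: stage_eq split: if_splits)
  have s_less: "\<forall>a\<in>set s. a < x"
    using hds(2) sorted_stacks(1) by (cases s) auto
  have less_t: "\<forall>b\<in>set t. x < b"
    using hds(1) sorted_stacks(2) by (cases t) auto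
  have smaller: "\<exists>z\<in>set xs'. \<forall>a\<in>set (x # s). z < a" if "s \<noteq> []"
  proof -
    obtain z where z: "z \<in> set xs" "\<forall>a\<in>set s. z < a"
      using smaller_in_input \<open>s \<noteq> []\<close> by blast
    have "z < x"
      using z(2) s_less \<open>s \<noteq> []\<close> by (cases s) auto
    with z show ?thesis
      by (auto simp: xs)
  qed
  have "completable xs' (x # s) t"
    using completable_m[unfolded xs]
  proof cases
    \<comment> \<open>Such a completion would have \<open>a\<close> in the second stack while the
      larger \<open>x\<close> stands in the input in front of some \<open>z < a\<close>.\<close>
    case (completable_N s' a)
    obtain z where z: "z \<in> set xs'" "z < a"
      using smaller completable_N by auto
    have "a < x"
      using s_less completable_N by simp
    then show ?thesis
      using not_completable[OF completable_N(2), of a z x] z by auto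
  next
    \<comment> \<open>A completion beginning with an output would output the least pending value,
      which is not in the second stack.\<close>
    case (completable_C t' y)
    have "y \<le> a" if "a \<in> set xs \<union> set s \<union> set t" for a
      using that completable_C by (auto simp: xs ball_Un less_imp_le)
    then have "y = Suc l"
      using least_pending(1) least_less[of y] completable_C(1) by fastforce
    then show ?thesis
      using not_stack2 completable_C by simp
  qed
  moreover have "pending (Machine xs' (x # s) t out) = [Suc l..<Suc n]"
    by (intro pending_move) (simp add: xs)
  moreover have least: "x = Suc l \<or> Suc l \<in> set xs'" if "s = []"
    using least_pending(1) not_stack2 that by (auto simp: xs)
  then have "x # s = [Suc l] \<or> (\<exists>z\<in>set xs'. \<forall>a\<in>set (x # s). z < a)"
    using smaller least_less[of x] by (cases "s = []") (auto simp: xs)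
  ultimately have "ADI_invariant n l (Machine xs' (x # s) t out)"
    using s_less less_t stacks_less by (auto simp: ADI_invariant_def simp del: upt_Suc)
  \<comment> \<open>This decides whether \<open>x\<close> is a right-to-left minimum. Over a
    nonempty first stack a smaller value is still to come; over an empty one \<open>Suc l\<close> is
    still to come unless it is \<open>x\<close>.\<close>
  moreover have "(\<forall>y\<in>set xs'. x < y) \<longleftrightarrow> s = [] \<and> x = Suc l"
  proof
    assume *: "\<forall>y\<in>set xs'. x < y"
    have "s = []"
      using smaller * by force
    with least * least_less[of x] show "s = [] \<and> x = Suc l"
      by (auto simp: xs)
  next
    assume "s = [] \<and> x = Suc l"
    then show "\<forall>y\<in>set xs'. x < y"
      using least_less distinct_pending unfolding xs by auto
  qed
  ultimately show thesis
    using that xs by blast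
qed

lemma case_push:
  assumes stage: "ADI_stage m = [OpN]"
  obtains a s' where "s = a # s'" "ADI_invariant n l (Machine xs s' (a # t) out)"
proof -
  have no_E: "\<not> (xs \<noteq> [] \<and> (t = [] \<or> hd xs < hd t) \<and> (s = [] \<or> hd s < hd xs))"
    using stage by (auto simp: stage_eq split: if_splits)
  from completable_m have "\<exists>a s'. s = a # s' \<and> completable xs s' (a # t)"
  proof cases
    case completable_done
    then show ?thesis
      using least_pending(1) by auto
  next
    \<comment> \<open>The completion puts \<open>x\<close> on the first stack, so \<open>x\<close>
      exceeds the entries there, and only the top \<open>y\<close> of the second stack can have made
      the algorithm refuse \<open>OpE\<close>. Then \<open>x\<close> and \<open>y\<close> block each
      other, with \<open>Suc l\<close> as the smaller value.\<close>
    case (completable_E xs' x)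
    have "\<forall>a\<in>set s. a < x"
      using completable_sorted[OF completable_E(2)] by simp
    then have "s = [] \<or> hd s < x"
      by (cases s) auto
    then obtain y t' where t: "t = y # t'" "\<not> x < y"
      using no_E completable_E(1) by (cases t) auto
    have "y < x"
      using t distinct_pending completable_E(1) by auto
    moreover have "Suc l < y"
      using least_less[of y] not_stack2 t by auto
    moreover have "Suc l \<in> set xs' \<union> set (x # s)"
      using least_pending(1) not_stack2 completable_E(1) by auto
    ultimately have False
      using not_completable[OF completable_E(2), of y "Suc l" x] t by auto
    then show ?thesis ..
  next
    case (completable_C t' y)
    have "y \<le> a" if "a \<in> set xs \<union> set s \<union> set t" for a
      using that completable_C by (auto simp: ball_Un less_imp_le)
    then have "y = Suc l"
      using least_pending(1) least_less[of y] completable_C(1) by fastforce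
    then show ?thesis
      using not_stack2 completable_C by simp
  qed blast
  then obtain a s' where s: "s = a # s'" "completable xs s' (a # t)"
    by blast
  have "pending (Machine xs s' (a # t) out) = [Suc l..<Suc n]"
    by (intro pending_move) (simp add: s)
  moreover have "\<forall>b\<in>set s'. \<forall>c\<in>set (a # t). b < c"
    using sorted_stacks(1) stacks_less by (auto simp: s)
  ultimately have "ADI_invariant n l (Machine xs s' (a # t) out)"
    using s smaller_in_input by (auto simp: ADI_invariant_def simp del: upt_Suc)
  with s show thesis
    using that by blast
qed

end
end
end

section \<open>From single stages to the whole run\<close>

lemma ADI_trace_ADI_from:
  assumes "ADI_invariant n l m"
  shows "ADI_trace l (input m) (stack1 m) (stack2 m) (ADI_from m)"
  using assms
proof (induction m arbitrary: l rule: ADI_from.induct)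
  case (1 m)
  obtain xs s t out where m: "m = Machine xs s t out"
    by (cases m)
  show ?case
  proof (cases "pending m = []")
    case True
    then have "xs @ s @ t = []"
      by (metis m machine.sel pending_def mset_sort mset_zero_iff_right)
    with True show ?thesis
      by (simp add: m ADI_from.simps trace_done)
  next
    case nonempty: False
    note facts = m "1.prems" nonempty
    have step: "ADI_trace l' (input m') (stack1 m') (stack2 m') (ADI_from m') \<and>
        ADI_from m = ADI_stage m @ ADI_from m'"
      if "run (ADI_stage m) m = Some m'" "ADI_invariant n l' m'" for l' m'
      using "1.IH"[OF nonempty that] that nonempty by (subst (2) ADI_from.simps) simp
    \<comment> \<open>These are step (1), step (2), and the choice between steps (3) and
      (4).\<close>
    consider "Suc l \<in> set t" | "s = [Suc l]" | "Suc l \<notin> set t" "s \<noteq> [Suc l]"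
      by blast
    then show ?thesis
    proof cases
      case 1
      then obtain t' where t: "t = Suc l # t'"
        using least_in_stack2_is_top[OF facts] by blast
      note out = case_output[OF facts 1]
      show ?thesis
        using step[OF _ out(3)] out(1,2) by (simp add: m t trace_output)
    next
      case 2
      note transfer = case_transfer[OF facts 2]
      show ?thesis
        using step[OF _ transfer(2)] transfer(1) 2 by (simp add: m trace_transfer)
    next
      case 3
      have least: "Suc l \<notin> set s"
        using least_not_in_stack1[OF facts 3] .
      consider "ADI_stage m = [OpE]" | "ADI_stage m = [OpN]"
        using stage_eq[OF facts 3] by presburger
      then show ?thesis
      proof cases
        case E: 1
        obtain x xs' where xs: "xs = x # xs'"
          and inv: "ADI_invariant n l (Machine xs' (x # s) t out)"
          and rtl: "(\<forall>y\<in>set xs'. x < y) \<longleftrightarrow> s = [] \<and> x = Suc l"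
          using case_enter[OF facts 3 E] by blast
        show ?thesis
          using step[OF _ inv] E trace_enter[OF _ _ rtl] least 3(1) by (simp add: m xs)
      next
        case N: 2
        obtain a s' where s: "s = a # s'" and inv: "ADI_invariant n l (Machine xs s' (a # t) out)"
          using case_push[OF facts 3 N] by blast
        show ?thesis
          using step[OF _ inv] N least 3(1) by (simp add: m s trace_push)
      qed
    qed
  qed
qed

lemma ADI_trace_ADI_word:
  assumes "p \<in> permutations_of_set {1..n}" "DI_sortable p"
  shows "ADI_trace 0 p [] [] (ADI_word p)"
proof -
  have "mset [Suc 0..<Suc n] = mset p"
    using permutations_of_setD[OF assms(1)]
    by (subst set_eq_iff_mset_eq_distinct[symmetric])
       (simp_all add: atLeastLessThanSuc_atLeastAtMost del: upt_Suc)
  then have "sort p = [Suc 0..<Suc n]"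
    by (intro properties_for_sort) (simp_all del: upt_Suc)
  then have "ADI_invariant n 0 (initial p)"
    using completable_if_DI_sortable[OF assms(2)]
    by (simp add: ADI_invariant_def initial_def pending_def del: upt_Suc)
  from ADI_trace_ADI_from[OF this] show ?thesis
    by (simp add: ADI_word_def initial_def)
qed

lemma ADI_trace_counts:
  "ADI_trace l xs s t w \<Longrightarrow>
     count_list w OpN = length xs + length s \<and>
     count_list w OpC = length xs + length s + length t"
  by (induction rule: ADI_trace.induct) auto

text \<open>Apart from outputs, the last move brings an entry to the second stack. Hence the
  contracted word ends with a north step, the one deleted by \<open>Phi\<close>.\<close>

lemma ADI_trace_last:
  "ADI_trace l xs s t w \<Longrightarrow>
     if xs = [] \<and> s = [] then filter (\<lambda>a. a \<noteq> OpC) w = []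
     else filter (\<lambda>a. a \<noteq> OpC) w \<noteq> [] \<and> last (filter (\<lambda>a. a \<noteq> OpC) w) = OpN"
  by (induction rule: ADI_trace.induct) (auto split: if_splits)


section \<open>Blocks of outputs and right-to-left minima\<close>

text \<open>The indices of those \<open>OpC\<close>'s that begin a block, where \<open>j\<close> counts the \<open>OpC\<close>'s
  that were read before and \<open>b\<close> tells whether the last letter read was \<open>OpC\<close>.\<close>

fun block_starts :: "nat \<Rightarrow> bool \<Rightarrow> oper list \<Rightarrow> nat set" where
  "block_starts j b [] = {}"
| "block_starts j b (OpC # w) = (if b then {} else {Suc j}) \<union> block_starts (Suc j) True w"
| "block_starts j b (_ # w) = block_starts j False w"

lemma block_starts_True:
  "block_starts j True w = block_starts (j + length (takeWhile (\<lambda>a. a = OpC) w)) False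
     (dropWhile (\<lambda>a. a = OpC) w)"
proof (induction w arbitrary: j)
  case (Cons a w)
  then show ?case by (cases a) auto
qed simp

text \<open>A block begins one place after the end of all earlier blocks. The empty sum belongs to
  the first block, and the full sum does not occur.\<close>

lemma block_starts_eq:
  "block_starts j False w =
     (\<lambda>i. Suc (j + sum_list (take i (C_blocks w)))) ` {..<length (C_blocks w)}"
proof (induction w arbitrary: j rule: C_blocks.induct)
  case (2 w)
  then show ?case
    by (simp add: block_starts_True lessThan_Suc_eq_insert_0 image_image add.assoc)
qed simp_all

lemma rtl_minima_Cons:
  "rtl_minima (x # xs) = (if \<forall>y\<in>set xs. x < y then {x} else {}) \<union> rtl_minima xs"
proof (rule set_eqI)
  fix v
  have "v \<in> rtl_minima (x # xs) \<longleftrightarrow>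
    (\<exists>i<Suc (length xs). v = (x # xs) ! i \<and>
      (\<forall>j<Suc (length xs). i < j \<longrightarrow> (x # xs) ! i < (x # xs) ! j))"
    by (auto simp: rtl_minima_def)
  also have "\<dots> \<longleftrightarrow> v = x \<and> (\<forall>y\<in>set xs. x < y) \<or> v \<in> rtl_minima xs"
    by (auto simp: rtl_minima_def Ex_less_Suc2 All_less_Suc2 all_set_conv_all_nth)
  finally show "v \<in> rtl_minima (x # xs) \<longleftrightarrow>
      v \<in> (if \<forall>y\<in>set xs. x < y then {x} else {}) \<union> rtl_minima xs"
    by (cases "\<forall>y\<in>set xs. x < y") auto
qed

text \<open>The \<open>l\<close>-th \<open>OpC\<close> outputs the value \<open>l\<close>, so
  starting indices are values. The extra set accounts for a minimum that has left the input but is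
  not yet output; \<open>b\<close> excludes a value that merely continues a block.\<close>

lemma block_starts_ADI_trace:
  assumes "ADI_trace l xs s t w"
  shows "block_starts l b w = rtl_minima xs \<union>
    (if s = [Suc l] \<or> t \<noteq> [] \<and> hd t = Suc l \<and> \<not> b then {Suc l} else {})"
  using assms
proof (induction arbitrary: b rule: ADI_trace.induct)
  case (trace_done l)
  then show ?case by (simp add: rtl_minima_def)
next
  case (trace_output l xs t w)
  then show ?case by auto
next
  case (trace_transfer l xs t w)
  then show ?case by auto
next
  case (trace_enter l xs x s t w)
  then have "t = [] \<or> hd t \<noteq> Suc l" "s \<noteq> [Suc l]"
    by (cases t; auto)+
  then show ?case
    using trace_enter.IH trace_enter.hyps(3) by (auto simp: rtl_minima_Cons)
next
  case (trace_push l xs s a t w)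
  then have "t = [] \<or> hd t \<noteq> Suc l" "s \<noteq> [Suc l]" "a \<noteq> Suc l" "a # s \<noteq> [Suc l]"
    by (cases t; auto)+
  then show ?case
    using trace_push.IH by auto
qed


section \<open>Heights of the diagonal steps\<close>

lemma sum_list_C_blocks: "sum_list (C_blocks w) = count_list w OpC"
proof (induction w rule: C_blocks.induct)
  case (2 w)
  have "count_list (takeWhile (\<lambda>a. a = OpC) w) OpC = length (takeWhile (\<lambda>a. a = OpC) w)"
    by (induction w) auto
  with 2 show ?case
    using count_list_append[of "takeWhile (\<lambda>a. a = OpC) w" "dropWhile (\<lambda>a. a = OpC) w" OpC] by simp
qed simp_all

lemma C_blocks_pos: "x \<in> set (C_blocks w) \<Longrightarrow> 0 < x"
  by (induction w rule: C_blocks.induct) auto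

lemma filter_dropWhile_OpC: "filter (\<lambda>a. a \<noteq> OpC) (dropWhile (\<lambda>a. a = OpC) w) = filter (\<lambda>a. a \<noteq> OpC) w"
  by (induction w) auto

lemma count_dropWhile_OpN: "count_list (dropWhile (\<lambda>a. a = OpC) w) OpN = count_list w OpN"
  by (induction w) auto

lemma count_contract: "count_list (contract w) StepN = count_list w OpN"
  by (induction w rule: contract.induct) (simp_all add: count_dropWhile_OpN)

lemma StepD_notin_contract: "StepD \<notin> set (contract w)"
  by (induction w rule: contract.induct) simp_all

lemma contract_eq_Nil_iff: "contract w = [] \<longleftrightarrow> filter (\<lambda>a. a \<noteq> OpC) w = []"
  by (induction w rule: contract.induct) simp_all

lemma last_contract:
  "filter (\<lambda>a. a \<noteq> OpC) w \<noteq> [] \<Longrightarrow> last (filter (\<lambda>a. a \<noteq> OpC) w) = OpN \<Longrightarrow> last (contract w) = StepN"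
  by (induction w rule: contract.induct)
     (auto simp: contract_eq_Nil_iff filter_dropWhile_OpC split: if_splits)

lemma diagonalize_append:
  "diagonalize L j (u @ v) = diagonalize L j u @ diagonalize L (j + count_list u StepN) v"
  by (induction L j u rule: diagonalize.induct) auto

lemma set_heights:
  "set (heights S) = {count_list (take (Suc i) S) StepN + count_list (take (Suc i) S) StepD |
     i. i < length S \<and> S ! i = StepD}"
  by (auto simp: heights_def)

lemma set_heights_Cons:
  "set (heights (a # S)) = (if a = StepD then {1} else {}) \<union>
     (\<lambda>h. h + (if a = StepE then 0 else 1)) ` set (heights S)"
proof (rule set_eqI)
  fix v
  have "v \<in> set (heights (a # S)) \<longleftrightarrow>
    (\<exists>i<Suc (length S). (a # S) ! i = StepD \<and> v =
      count_list (take (Suc i) (a # S)) StepN + count_list (take (Suc i) (a # S)) StepD)"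
    by (auto simp: set_heights simp del: take_Suc_Cons)
  also have "\<dots> \<longleftrightarrow> a = StepD \<and> v = 1 \<or>
      v \<in> (\<lambda>h. h + (if a = StepE then 0 else 1)) ` set (heights S)"
    by (cases a) (auto simp: set_heights Ex_less_Suc2)
  finally show "v \<in> set (heights (a # S)) \<longleftrightarrow> v \<in> (if a = StepD then {1} else {}) \<union>
     (\<lambda>h. h + (if a = StepE then 0 else 1)) ` set (heights S)"
    by auto
qed

text \<open>Turning north steps into diagonal ones keeps all y-coordinates, so the
  \<open>l\<close>-th north step still ends at height \<open>l\<close>; adding \<open>j\<close>
  restores the steps read before \<open>w\<close>.\<close>

lemma heights_diagonalize:
  "StepD \<notin> set w \<Longrightarrow>
    (+) j ` set (heights (diagonalize L j w)) = L \<inter> {j<..j + count_list w StepN}"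
proof (induction L j w rule: diagonalize.induct)
  case (1 L j)
  then show ?case by (simp add: heights_def)
next
  case (2 L j w)
  have "(+) j ` set (heights (diagonalize L j (StepN # w))) =
      (if Suc j \<in> L then {Suc j} else {}) \<union> (+) (Suc j) ` set (heights (diagonalize L (Suc j) w))"
    by (simp add: set_heights_Cons image_Un image_image)
  also have "\<dots> = L \<inter> {j<..j + count_list (StepN # w) StepN}"
  proof -
    have "{j<..j + count_list (StepN # w) StepN} =
        insert (Suc j) {Suc j<..Suc j + count_list w StepN}"
      by auto
    then show ?thesis
      using 2 by simp
  qed
  finally show ?case .
next
  case ("3_1" L j w)
  then show ?case by (simp add: set_heights_Cons)
next
  case ("3_2" L j w)
  then show ?case by simp
qed

section \<open>Partial sums of the block lengths\<close>

lemma sum_list_take_pos: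
  fixes xs :: "nat list"
  assumes "\<forall>x\<in>set xs. 0 < x" "0 < i" "i < length xs"
  shows "0 < sum_list (take i xs)"
  using assms by (cases xs; cases i) auto

lemma sum_list_take_less:
  fixes xs :: "nat list"
  assumes "\<forall>x\<in>set xs. 0 < x" "i < length xs"
  shows "sum_list (take i xs) < sum_list xs"
proof -
  have "0 < sum_list (drop i xs)"
    using assms by (simp add: Cons_nth_drop_Suc[symmetric])
  then show ?thesis
    using sum_list_append[of "take i xs" "drop i xs"] by simp
qed

text \<open>Since all blocks are nonempty, only the sum of all of them reaches the total.\<close>

lemma partial_sums_below_total:
  assumes "\<forall>x\<in>set \<tau>. 0 < x"
  shows "partial_sums \<tau> \<inter> {0<..<sum_list \<tau>} = (\<lambda>i. sum_list (take i \<tau>)) ` {1..<length \<tau>}"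
proof (rule set_eqI)
  fix v
  have "v \<in> partial_sums \<tau> \<inter> {0<..<sum_list \<tau>} \<longleftrightarrow>
      (\<exists>i\<in>{1..length \<tau>}. v = sum_list (take i \<tau>) \<and> 0 < v \<and> v < sum_list \<tau>)"
    by (auto simp: partial_sums_def)
  also have "\<dots> \<longleftrightarrow> (\<exists>i\<in>{1..<length \<tau>}. v = sum_list (take i \<tau>))"
    using sum_list_take_less[OF assms] sum_list_take_pos[OF assms]
    by (auto simp: Bex_def le_less)
  finally show "v \<in> partial_sums \<tau> \<inter> {0<..<sum_list \<tau>} \<longleftrightarrow>
      v \<in> (\<lambda>i. sum_list (take i \<tau>)) ` {1..<length \<tau>}"
    by auto
qed

theorem theorem4p6:
  fixes n :: nat and \<pi> :: "nat list" and W :: "oper list" and h :: "nat list"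
  assumes "n \<ge> 1"
    and "\<pi> \<in> permutations_of_set {1..n}"
    and "DI_sortable \<pi>"
    and "W = ADI_word \<pi>"
    and "h = heights (Phi W)"
  shows "rtl_minima \<pi> = {1} \<union> {h ! i + 1 | i. i < length h}"
proof -
  have trace: "ADI_trace 0 \<pi> [] [] W"
    using ADI_trace_ADI_word assms by blast
  have len: "length \<pi> = n"
    using assms(2) length_finite_permutations_of_set by fastforce
  define \<tau> where "\<tau> = C_blocks W"
  have pos: "\<forall>x\<in>set \<tau>. 0 < x"
    by (simp add: \<tau>_def C_blocks_pos)
  have total: "sum_list \<tau> = n"
    using ADI_trace_counts[OF trace] by (simp add: \<tau>_def sum_list_C_blocks len)
  then have "\<tau> \<noteq> []"
    using assms(1) by auto
  have "\<pi> \<noteq> []"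
    using len assms(1) by auto
  then have "contract W \<noteq> []" "last (contract W) = StepN"
    using ADI_trace_last[OF trace] last_contract contract_eq_Nil_iff by auto
  then obtain T where T: "contract W = T @ [StepN]"
    by (metis append_butlast_last_id)
  have "Suc (count_list T StepN) = n"
    using count_contract[of W] ADI_trace_counts[OF trace] by (simp add: T len)
  \<comment> \<open>\<open>diagonalize\<close> acts letter by letter, so deleting the last letter
    may be done before it.\<close>
  moreover have "Phi W = diagonalize (partial_sums \<tau>) 0 T"
    by (simp add: Phi_def T \<tau>_def diagonalize_append)
  moreover have "StepD \<notin> set T"
    using StepD_notin_contract[of W] by (simp add: T)
  \<comment> \<open>\<open>T\<close> has \<open>n - 1\<close> north steps, so the last partial sum
    \<open>n\<close> contributes no height.\<close>
  ultimately have "set h = partial_sums \<tau> \<inter> {0<..<sum_list \<tau>}"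
    using heights_diagonalize[where j = 0 and L = "partial_sums \<tau>" and w = T] assms(5) total
    by (auto simp: set_eq_iff less_Suc_eq_le[symmetric])
  also have "\<dots> = (\<lambda>i. sum_list (take i \<tau>)) ` {1..<length \<tau>}"
    by (rule partial_sums_below_total[OF pos])
  finally have set_h: "set h = (\<lambda>i. sum_list (take i \<tau>)) ` {1..<length \<tau>}" .
  have "rtl_minima \<pi> = (\<lambda>i. Suc (sum_list (take i \<tau>))) ` {..<length \<tau>}"
    using block_starts_ADI_trace[OF trace, of False] by (simp add: block_starts_eq \<tau>_def)
  \<comment> \<open>Index \<open>0\<close>, the start of the first block, gives the minimum
    \<open>1\<close>; the other indices give the heights.\<close>
  also have "{..<length \<tau>} = insert 0 {1..<length \<tau>}"
    using \<open>\<tau> \<noteq> []\<close> by auto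
  also have "(\<lambda>i. Suc (sum_list (take i \<tau>))) ` insert 0 {1..<length \<tau>} = {1} \<union> Suc ` set h"
    by (simp add: set_h image_image)
  also have "Suc ` set h = {h ! i + 1 | i. i < length h}"
    by (auto simp: set_conv_nth)
  finally show ?thesis .
qed

end
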